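(* Let $\tau_{\mathcal R}>0$ and $\tau_\psi>0$, and let $\mathcal Z_c\subset\mathbb R^m$ be nonempty and compact. Suppose that: (1) for each $k=1,\dots,m$ the map $\frac{\partial A}{\partial z_k}$ is Lipschitz continuous on $\mathbb R^m$; (2) there is $C_A>0$ with $\left\|\frac{\partial A}{\partial z_k}(z)\right\|_2\le C_A$ for all $z\in\mathbb R^m$ and $k=1,\dots,m$; (3) the map $\frac{\partial b}{\partial z}$ is Lipschitz continuous on $\mathbb R^m$; (4) there is $C_b>0$ with $\left\|\frac{\partial b}{\partial z}(z)\right\|_2\le C_b$ for all $z\in\mathbb R^m$; (5) $F\in C^1(\mathbb R^m\times\mathbb R^n,\mathbb R)$ is $L_F$-smooth, i.e. $\|\nabla F(w_1)-\nabla F(w_2)\|_2\le L_F\|w_1-w_2\|_2$ for all $w_1,w_2$. Then the quantities $$\overline C_{\mathcal R}=\sup_{z\in\mathcal Z_c}C_{\mathcal R}(z),\qquad \overline C_{\mathcal Y}=\sup_{z\in\mathcal Z_c}C_{\mathcal Y_z},\qquad \overline M_F=\sup_{z\in\mathcal Z_c}M_F(z)$$ are finite and, for every $z\in\mathcal Z_c$, every $y\in\mathcal Y_z$ and every $\psi\in\mathcal A_{z,y}$, the inexact adjoint gradient $\overline\nabla\widetilde F(z)$ formed from $(y,\psi)$ satisfies $$\|\overline\nabla\widetilde F(z)-\nabla\widetilde F(z)\|_2\le\overline D_{\mathcal R}\,\tau_{\mathcal R}+\overline D_\psi\,\tau_\psi,$$ where $$\overline D_\psi=\big(\sqrt m\,C_A\overline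 C_{\mathcal Y}+C_b\big)\overline C_{\mathcal R},$$ $$\overline D_{\mathcal R}=L_F\overline C_{\mathcal R}+L_F\big(\sqrt m\,C_A\overline C_{\mathcal Y}+C_b\big)\overline C_{\mathcal R}^2+\sqrt m\,C_A\overline M_F\overline C_{\mathcal R}^2.$$
   Context: Vectors carry the Euclidean norm $\|\cdot\|_2$ and matrices the induced spectral norm $\|\cdot\|_2$. The residual is affine in the state: $R(z,y)=A(z)y-b(z)$, where $A:\mathbb R^m\to GL(n)$ (invertible real $n\times n$ matrices) and $b:\mathbb R^m\to\mathbb R^n$ are $C^1$. Its partial Jacobian in $z$ is the $n\times m$ matrix $\frac{\partial R}{\partial z}(z,y)=\frac{\partial A}{\partial z}(z)y-\frac{\partial b}{\partial z}(z)$, where $\frac{\partial A}{\partial z}(z)y$ is the matrix whose $k$-th column is $\frac{\partial A}{\partial z_k}(z)y$. $F:\mathbb R^m\times\mathbb R^n\to\mathbb R$ is the full objective, with partial gradients $\nabla_zF,\nabla_yF$. For each $z$: the exact state is $y^*_z=A(z)^{-1}b(z)$; $\mathcal Y_z=\{y\in\mathbb R^n:\|A(z)y-b(z)\|_2\le\tau_{\mathcal R}\}$; $C_{\mathcal R}(z)=\|A(z)^{-1}\|_2$; for $y\in\mathcal Y_z$ the exact adjoint $\psi^*_{z,y}$ is the solution of $A(z)^{\mathsf T}\psi^*_{z,y}=\nabla_yF(z,y)$; $\mathcal A_{z,y}=\{\psi\in\mathbb R^n:\|A(z)^{\mathsf T}\psi-\nabla_yF(z,y)\|_2\le\tau_\psi\}$;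 $M_F(z)=\sup_{y\in\mathcal Y_z}\|\nabla_yF(z,y)\|_2$; $C_{\mathcal Y_z}=\sup_{y\in\mathcal Y_z}\|y\|_2$. The inexact adjoint gradient formed from $y\in\mathcal Y_z$, $\psi\in\mathcal A_{z,y}$ is $\overline\nabla\widetilde F(z)=\nabla_zF(z,y)-\left[\frac{\partial R}{\partial z}(z,y)\right]^{\mathsf T}\psi$. The exact reduced gradient (the gradient of $\widetilde F(z)=F(z,y^*_z)$) is $\nabla\widetilde F(z)=\nabla_zF(z,y^*_z)-\left[\frac{\partial R}{\partial z}(z,y^*_z)\right]^{\mathsf T}\psi^*_{z,y^*_z}$. *)

theory Defs
  imports "HOL-Analysis.Analysis"
begin

section \<open>Calculus notions\<close>

definition C1_map :: "('a::real_normed_vector \<Rightarrow> 'b::real_normed_vector) \<Rightarrow> bool" where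
  "C1_map f \<longleftrightarrow> (\<exists>f'. (\<forall>x. (f has_derivative blinfun_apply (f' x)) (at x)) \<and> continuous_on UNIV f')"

definition gradient :: "('a::real_inner \<Rightarrow> real) \<Rightarrow> 'a \<Rightarrow> 'a" where
  "gradient f x = (THE g. GDERIV f x :> g)"

definition partial_deriv :: "'m::finite \<Rightarrow> (real^'m \<Rightarrow> 'b::real_normed_vector) \<Rightarrow> real^'m \<Rightarrow> 'b" where
  "partial_deriv k f z = vector_derivative (\<lambda>t. f (z + t *\<^sub>R axis k 1)) (at 0)"

text \<open>The \<^term>\<open>norm\<close> of the type \<open>real^'m^'n\<close> is the Frobenius norm, so the
  spectral norm has to be introduced separately.\<close>

definition spectral_norm :: "real^'m^'n \<Rightarrow> real" where
  "spectral_norm M = onorm ((*v) M)"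

definition spectral_Lipschitz :: "('a::metric_space \<Rightarrow> real^'m^'n) \<Rightarrow> bool" where
  "spectral_Lipschitz G \<longleftrightarrow> (\<exists>L\<ge>0. \<forall>z w. spectral_norm (G z - G w) \<le> L * dist z w)"


section \<open>State, adjoint and reduced gradient\<close>

definition residual ::
    "(real^'m \<Rightarrow> real^'n^'n) \<Rightarrow> (real^'m \<Rightarrow> real^'n) \<Rightarrow> real^'m \<Rightarrow> real^'n \<Rightarrow> real^'n" where
  "residual A b z y = A z *v y - b z"

definition residual_dz ::
    "(real^'m \<Rightarrow> real^'n^'n) \<Rightarrow> (real^'m \<Rightarrow> real^'n) \<Rightarrow> real^'m \<Rightarrow> real^'n \<Rightarrow> real^'m^'n" where
  "residual_dz A b z y = jacobian (\<lambda>z'. residual A b z' y) (at z)"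

definition grad_z :: "((real^'m) \<times> (real^'n) \<Rightarrow> real) \<Rightarrow> real^'m \<Rightarrow> real^'n \<Rightarrow> real^'m" where
  "grad_z F z y = gradient (\<lambda>z'. F (z', y)) z"

definition grad_y :: "((real^'m) \<times> (real^'n) \<Rightarrow> real) \<Rightarrow> real^'m \<Rightarrow> real^'n \<Rightarrow> real^'n" where
  "grad_y F z y = gradient (\<lambda>y'. F (z, y')) y"

definition exact_state ::
    "(real^'m \<Rightarrow> real^'n^'n) \<Rightarrow> (real^'m \<Rightarrow> real^'n) \<Rightarrow> real^'m \<Rightarrow> real^'n" where
  "exact_state A b z = matrix_inv (A z) *v b z"

definition inexact_states ::
    "(real^'m \<Rightarrow> real^'n^'n) \<Rightarrow> (real^'m \<Rightarrow> real^'n) \<Rightarrow> real \<Rightarrow> real^'m \<Rightarrow> (real^'n) set" where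
  "inexact_states A b tauR z = {y. norm (residual A b z y) \<le> tauR}"

definition exact_adjoint ::
    "(real^'m \<Rightarrow> real^'n^'n) \<Rightarrow> ((real^'m) \<times> (real^'n) \<Rightarrow> real) \<Rightarrow> real^'m \<Rightarrow> real^'n \<Rightarrow> real^'n" where
  "exact_adjoint A F z y = (THE \<psi>. transpose (A z) *v \<psi> = grad_y F z y)"

definition inexact_adjoints ::
    "(real^'m \<Rightarrow> real^'n^'n) \<Rightarrow> ((real^'m) \<times> (real^'n) \<Rightarrow> real) \<Rightarrow> real \<Rightarrow> real^'m \<Rightarrow> real^'n
      \<Rightarrow> (real^'n) set" where
  "inexact_adjoints A F tauPsi z y = {\<psi>. norm (transpose (A z) *v \<psi> - grad_y F z y) \<le> tauPsi}"

definition C_R :: "(real^'m \<Rightarrow> real^'n^'n) \<Rightarrow> real^'m \<Rightarrow> real" where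
  "C_R A z = spectral_norm (matrix_inv (A z))"

text \<open>Suprema are taken in \<^typ>\<open>ereal\<close>, where an unbounded family has supremum \<open>\<infinity>\<close>;
  this gives their finiteness its literal meaning.\<close>

definition C_Y ::
    "(real^'m \<Rightarrow> real^'n^'n) \<Rightarrow> (real^'m \<Rightarrow> real^'n) \<Rightarrow> real \<Rightarrow> real^'m \<Rightarrow> ereal" where
  "C_Y A b tauR z = (SUP y\<in>inexact_states A b tauR z. ereal (norm y))"

definition M_F ::
    "(real^'m \<Rightarrow> real^'n^'n) \<Rightarrow> (real^'m \<Rightarrow> real^'n) \<Rightarrow> ((real^'m) \<times> (real^'n) \<Rightarrow> real) \<Rightarrow> real
      \<Rightarrow> real^'m \<Rightarrow> ereal" where
  "M_F A b F tauR z = (SUP y\<in>inexact_states A b tauR z. ereal (norm (grad_y F z y)))"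

definition reduced_objective ::
    "(real^'m \<Rightarrow> real^'n^'n) \<Rightarrow> (real^'m \<Rightarrow> real^'n) \<Rightarrow> ((real^'m) \<times> (real^'n) \<Rightarrow> real)
      \<Rightarrow> real^'m \<Rightarrow> real" where
  "reduced_objective A b F z = F (z, exact_state A b z)"

text \<open>The formula for the inexact adjoint gradient, evaluated at the exact state and the exact
  adjoint, is the gradient of \<^const>\<open>reduced_objective\<close>; see \<open>gradient_reduced_objective\<close> below.\<close>

definition adjoint_gradient ::
    "(real^'m \<Rightarrow> real^'n^'n) \<Rightarrow> (real^'m \<Rightarrow> real^'n) \<Rightarrow> ((real^'m) \<times> (real^'n) \<Rightarrow> real)
      \<Rightarrow> real^'m \<Rightarrow> real^'n \<Rightarrow> real^'n \<Rightarrow> real^'m" where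
  "adjoint_gradient A b F z y \<psi> = grad_z F z y - transpose (residual_dz A b z y) *v \<psi>"


section \<open>Consistency of the definitions\<close>

lemma GDERIV_unique:
  assumes "GDERIV f x :> g" "GDERIV f x :> h"
  shows "g = h"
proof -
  have "(\<lambda>v. v \<bullet> g) = (\<lambda>v. v \<bullet> h)"
    using assms has_derivative_unique unfolding gderiv_def by blast
  then have "v \<bullet> g = v \<bullet> h" for v by meson
  then show ?thesis using vector_eq_ldot by blast
qed

lemma gradient_eqI: "GDERIV f x :> g \<Longrightarrow> gradient f x = g"
  unfolding gradient_def using GDERIV_unique by blast

lemma GDERIV_gradient:
  fixes f :: "'a::euclidean_space \<Rightarrow> real"
  assumes "f differentiable (at x)"
  shows "GDERIV f x :> gradient f x"
proof -
  obtain f' where f': "(f has_derivative f') (at x)"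
    using assms by (auto simp: differentiable_def)
  have "f' = (\<lambda>h. h \<bullet> adjoint f' 1)"
    using adjoint_works[OF has_derivative_linear[OF f'], of _ 1] by (simp add: fun_eq_iff)
  then have "GDERIV f x :> adjoint f' 1"
    unfolding gderiv_def using has_derivative_subst[OF f'] by blast
  then show ?thesis using gradient_eqI by metis
qed

lemma C1_map_differentiable: "C1_map f \<Longrightarrow> f differentiable (at x)"
  unfolding C1_map_def differentiable_def by blast

lemma bounded_bilinear_matrix_vector_mult:
  "bounded_bilinear (\<lambda>(M::real^'m^'n) x. M *v x)"
  unfolding bilinear_conv_bounded_bilinear[symmetric] bilinear_def
  by (auto intro!: linearI simp: matrix_vector_mult_add_rdistrib matrix_vector_right_distrib
      matrix_vector_mult_scaleR scaleR_matrix_vector_assoc)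

lemma partial_deriv_eq:
  assumes "(f has_derivative f') (at z)"
  shows "partial_deriv k f z = f' (axis k 1)"
proof -
  have 1: "((\<lambda>t. z + t *\<^sub>R axis k 1) has_derivative (\<lambda>t. t *\<^sub>R axis k 1)) (at 0)"
    by (auto intro!: derivative_eq_intros)
  have "((\<lambda>t. f (z + t *\<^sub>R axis k 1)) has_derivative (\<lambda>t. f' (t *\<^sub>R axis k 1))) (at 0)"
    using has_derivative_compose[OF 1] assms by simp
  then have "((\<lambda>t. f (z + t *\<^sub>R axis k 1)) has_vector_derivative f' (axis k 1)) (at 0)"
    using linear_scale[OF has_derivative_linear[OF assms]] by (simp add: has_vector_derivative_def)
  then show ?thesis unfolding partial_deriv_def by (rule vector_derivative_at)
qed

lemma residual_dz_has_derivative: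
  assumes "A differentiable (at z)" "b differentiable (at z)"
  shows "((\<lambda>z'. residual A b z' y) has_derivative (\<lambda>h. residual_dz A b z y *v h)) (at z)"
proof -
  obtain A' b' where A': "(A has_derivative A') (at z)" and b': "(b has_derivative b') (at z)"
    using assms by (auto simp: differentiable_def)
  have "(\<lambda>z'. residual A b z' y) differentiable (at z)"
    unfolding residual_def differentiable_def
    using has_derivative_diff[OF bounded_bilinear.FDERIV[OF bounded_bilinear_matrix_vector_mult A'
          has_derivative_const[of y]] b'] by blast
  then show ?thesis unfolding residual_dz_def by (simp add: jacobian_works)
qed

lemma residual_dz_eq:
  assumes "A differentiable (at z)" "b differentiable (at z)"
  shows "residual_dz A b z y = (\<chi> i k. (partial_deriv k A z *v y) $ i) - jacobian b (at z)"
proof -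
  obtain A' b' where A': "(A has_derivative A') (at z)" and b': "(b has_derivative b') (at z)"
    using assms by (auto simp: differentiable_def)
  have "((\<lambda>z'. residual A b z' y) has_derivative (\<lambda>h. A z *v 0 + A' h *v y - b' h)) (at z)"
    unfolding residual_def
    using has_derivative_diff[OF bounded_bilinear.FDERIV[OF bounded_bilinear_matrix_vector_mult A'
          has_derivative_const[of y]] b'] .
  then have "frechet_derivative (\<lambda>z'. residual A b z' y) (at z) = (\<lambda>h. A' h *v y - b' h)"
    by (metis (no_types, lifting) ext add_0 frechet_derivative_at matrix_vector_mult_0_right)
  moreover have "frechet_derivative b (at z) = b'"
    using b' frechet_derivative_at by metis
  ultimately show ?thesis
    unfolding residual_dz_def jacobian_def
    by (simp add: matrix_def vec_eq_iff partial_deriv_eq[OF A'])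
qed

lemma matrix_inv_works:
  fixes M :: "'a::semiring_1^'n^'n"
  assumes "invertible M"
  shows "M ** matrix_inv M = mat 1" "matrix_inv M ** M = mat 1"
  using someI_ex[OF assms[unfolded invertible_def]] unfolding matrix_inv_def by auto

lemma exact_state_solves:
  assumes "invertible (A z)"
  shows "A z *v exact_state A b z = b z"
  using matrix_inv_works(1)[OF assms] unfolding exact_state_def
  by (simp add: matrix_vector_mul_assoc)

lemma exact_adjoint_solves:
  fixes A :: "real^'m \<Rightarrow> real^'n^'n"
  assumes "invertible (A z)"
  shows "transpose (A z) *v exact_adjoint A F z y = grad_y F z y"
proof -
  have inv: "invertible (transpose (A z))" using assms by (rule transpose_invertible)
  have "\<exists>!\<psi>. transpose (A z) *v \<psi> = grad_y F z y"
  proof (rule ex1I)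
    show "transpose (A z) *v (matrix_inv (transpose (A z)) *v grad_y F z y) = grad_y F z y"
      using matrix_inv_works(1)[OF inv] by (simp add: matrix_vector_mul_assoc)
  next
    fix \<psi> assume "transpose (A z) *v \<psi> = grad_y F z y"
    then have "matrix_inv (transpose (A z)) *v grad_y F z y
        = (matrix_inv (transpose (A z)) ** transpose (A z)) *v \<psi>"
      by (metis matrix_vector_mul_assoc)
    then show "\<psi> = matrix_inv (transpose (A z)) *v grad_y F z y"
      using matrix_inv_works(2)[OF inv] by simp
  qed
  then show ?thesis unfolding exact_adjoint_def by (rule theI')
qed

lemma differentiable_vec_iff:
  fixes f :: "'a::real_normed_vector \<Rightarrow> 'b::euclidean_space^'n"
  shows "f differentiable (at z) \<longleftrightarrow> (\<forall>i. (\<lambda>x. f x $ i) differentiable (at z))"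
proof
  assume "f differentiable (at z)"
  then show "\<forall>i. (\<lambda>x. f x $ i) differentiable (at z)"
    unfolding differentiable_def
    using bounded_linear.has_derivative[OF bounded_linear_vec_nth] by blast
next
  assume *: "\<forall>i. (\<lambda>x. f x $ i) differentiable (at z)"
  show "f differentiable (at z)"
    unfolding differentiable_componentwise_within[of f]
  proof
    fix u :: "'b^'n" assume "u \<in> Basis"
    then obtain i v where u: "u = axis i v" by (auto simp: Basis_vec_def)
    obtain D where "((\<lambda>x. f x $ i) has_derivative D) (at z)"
      using * by (auto simp: differentiable_def)
    from has_derivative_inner_left[OF this, of v]
    show "(\<lambda>x. f x \<bullet> u) differentiable at z"
      by (auto simp: u inner_axis differentiable_def)
  qed
qed

lemma differentiable_prod:
  fixes f :: "'i \<Rightarrow> 'a::real_normed_vector \<Rightarrow> real"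
  assumes "\<And>i. i \<in> I \<Longrightarrow> f i differentiable (at z)"
  shows "(\<lambda>x. \<Prod>i\<in>I. f i x) differentiable (at z)"
proof -
  obtain D where "\<And>i. i \<in> I \<Longrightarrow> (f i has_derivative D i) (at z)"
    using assms unfolding differentiable_def by metis
  then show ?thesis
    unfolding differentiable_def by (intro exI) (rule has_derivative_prod)
qed

lemma differentiable_det:
  fixes M :: "'a::real_normed_vector \<Rightarrow> real^'n^'n"
  assumes "\<And>i j. (\<lambda>x. M x $ i $ j) differentiable (at z)"
  shows "(\<lambda>x. det (M x)) differentiable (at z)"
  unfolding det_def
  by (intro differentiable_sum ballI differentiable_mult differentiable_prod assms) auto

lemma exact_state_differentiable:
  fixes A :: "real^'m \<Rightarrow> real^'n^'n"
  assumes "A differentiable (at z)" "b differentiable (at z)" "\<And>z. invertible (A z)"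
  shows "exact_state A b differentiable (at z)"
proof -
  have det: "det (A x) \<noteq> 0" for x
    using assms(3) invertible_det_nz by blast
  have state: "exact_state A b x
      = (\<chi> k. det (\<chi> i j. if j = k then b x $ i else A x $ i $ j) / det (A x))" for x
    using iffD1[OF cramer[OF det] exact_state_solves[OF assms(3)]] .
  have A: "(\<lambda>x. A x $ i $ j) differentiable (at z)" for i j
    using assms(1) by (simp add: differentiable_vec_iff)
  have b: "(\<lambda>x. b x $ i) differentiable (at z)" for i
    using assms(2) by (simp add: differentiable_vec_iff)
  have "(\<lambda>x. exact_state A b x $ k) differentiable (at z)" for k
    unfolding state vec_lambda_beta
  proof (intro differentiable_divide differentiable_det A det)
    fix i j
    show "(\<lambda>x. (\<chi> i j. if j = k then b x $ i else A x $ i $ j) $ i $ j) differentiable at z"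
      using A[of i j] b[of i] by (cases "j = k") simp_all
  qed
  then show ?thesis by (simp add: differentiable_vec_iff)
qed

theorem gradient_reduced_objective:
  fixes A :: "real^'m \<Rightarrow> real^'n^'n" and F :: "(real^'m) \<times> (real^'n) \<Rightarrow> real"
  assumes A: "A differentiable (at z)" and b: "b differentiable (at z)"
    and inv: "\<And>z. invertible (A z)"
    and F: "F differentiable (at (z, exact_state A b z))"
  defines "y \<equiv> exact_state A b z"
  shows "GDERIV (reduced_objective A b F) z :> adjoint_gradient A b F z y (exact_adjoint A F z y)"
proof -
  define \<psi> where "\<psi> = exact_adjoint A F z y"
  define R where "R = residual_dz A b z y"
  obtain s where s: "(exact_state A b has_derivative s) (at z)"
    using exact_state_differentiable[OF A b inv] by (auto simp: differentiable_def)
  obtain A' b' where A': "(A has_derivative A') (at z)" and b': "(b has_derivative b') (at z)"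
    using A b by (auto simp: differentiable_def)
  note bil = bounded_bilinear.FDERIV[OF bounded_bilinear_matrix_vector_mult A']
  have "b' = (\<lambda>h. A z *v s h + A' h *v y)"
    using bil[OF s] b' unfolding exact_state_solves[of A, OF inv] y_def
    by (rule has_derivative_unique[rotated])
  moreover have "(\<lambda>h. R *v h) = (\<lambda>h. A z *v 0 + A' h *v y - b' h)"
    using residual_dz_has_derivative[OF A b, of y]
      has_derivative_diff[OF bil[OF has_derivative_const[of y]] b']
    unfolding residual_def R_def by (rule has_derivative_unique)
  ultimately have As: "A z *v s h = - (R *v h)" for h
    by (metis (no_types, lifting) add.commute add_diff_cancel_left' add_0 minus_diff_eq
        matrix_vector_mult_0_right)
  obtain F' where F': "(F has_derivative F') (at (z, y))"
    using F by (auto simp: differentiable_def y_def)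
  have Fz: "((\<lambda>z'. F (z', y)) has_derivative (\<lambda>h. F' (h, 0))) (at z)"
    using has_derivative_compose[OF has_derivative_Pair[OF has_derivative_ident
          has_derivative_const[of y]] F'] .
  have Fy: "((\<lambda>y'. F (z, y')) has_derivative (\<lambda>h. F' (0, h))) (at y)"
    using has_derivative_compose[OF has_derivative_Pair[OF has_derivative_const[of z]
          has_derivative_ident] F'] .
  have gz: "F' (h, 0) = h \<bullet> grad_z F z y" for h
    using GDERIV_gradient[of "\<lambda>z'. F (z', y)" z] Fz has_derivative_unique
    unfolding grad_z_def gderiv_def differentiable_def by metis
  have gy: "F' (0, h) = h \<bullet> grad_y F z y" for h
    using GDERIV_gradient[of "\<lambda>y'. F (z, y')" y] Fy has_derivative_unique
    unfolding grad_y_def gderiv_def differentiable_def by metis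
  have F'_eq: "F' (h, s h) = h \<bullet> adjoint_gradient A b F z y \<psi>" for h
  proof -
    have "F' (h, s h) = F' (h, 0) + F' (0, s h)"
      using linear_add[OF has_derivative_linear[OF F'], of "(h, 0)" "(0, s h)"] by simp
    also have "\<dots> = h \<bullet> grad_z F z y + s h \<bullet> (transpose (A z) *v \<psi>)"
      using exact_adjoint_solves[of A z F y, OF inv] by (simp add: gz gy \<psi>_def)
    also have "s h \<bullet> (transpose (A z) *v \<psi>) = - ((R *v h) \<bullet> \<psi>)"
      by (simp add: transpose_matrix_vector inner_commute[of "s h"] dot_lmul_matrix As
          inner_commute[of \<psi>])
    also have "(R *v h) \<bullet> \<psi> = h \<bullet> (transpose R *v \<psi>)"
      by (simp add: transpose_matrix_vector inner_commute[of h] dot_lmul_matrix inner_commute[of \<psi>])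
    finally show ?thesis
      by (simp add: adjoint_gradient_def R_def inner_diff_right)
  qed
  have "((\<lambda>z. F (z, exact_state A b z)) has_derivative (\<lambda>h. F' (h, s h))) (at z)"
    using has_derivative_compose[OF has_derivative_Pair[OF has_derivative_ident s], of F F'] F'
    by (simp add: y_def)
  then show ?thesis
    unfolding gderiv_def reduced_objective_def F'_eq \<psi>_def .
qed

end

theory Submission
  imports Defs
begin

text \<open>Since \<open>y - y\<^sup>* = A\<^sup>-\<^sup>1 (A y - b)\<close>, the state error is at most \<open>C\<^sub>R \<tau>\<^sub>R\<close>; likewise the adjoint error
  is at most \<open>C\<^sub>R \<tau>\<^sub>\<psi>\<close>.  With \<open>\<psi>\<^sub>y\<close> the exact adjoint at the inexact state \<open>y\<close>, the error of the gradient
  splits into the four differences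
  \<open>\<nabla>\<^sub>z F(y) - \<nabla>\<^sub>z F(y\<^sup>*)\<close>, \<open>R\<^sub>z(y)\<^sup>T (\<psi> - \<psi>\<^sub>y)\<close>, \<open>R\<^sub>z(y\<^sup>*)\<^sup>T (\<psi>\<^sub>y - \<psi>\<^sup>*)\<close> and \<open>(R\<^sub>z(y) - R\<^sub>z(y\<^sup>*))\<^sup>T \<psi>\<^sub>y\<close>.
  The suprema are finite because \<open>\<parallel>A(z) x\<parallel>\<close> attains a positive minimum over \<open>z \<in> Z\<^sub>c\<close>, \<open>\<parallel>x\<parallel> = 1\<close>.\<close>

section \<open>Spectral norms of products, transposes and column-wise assembled matrices\<close>

lemma norm_mult_vec_le: "norm (M *v x) \<le> spectral_norm M * norm x"
  unfolding spectral_norm_def by (rule onorm) simp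

lemma spectral_norm_nonneg: "0 \<le> spectral_norm M"
  unfolding spectral_norm_def by (rule onorm_pos_le) simp

lemma spectral_norm_leI: "(\<And>x. norm (M *v x) \<le> B * norm x) \<Longrightarrow> spectral_norm M \<le> B"
  unfolding spectral_norm_def by (rule onorm_le)

text \<open>Pair \<open>transpose M *v v\<close> with itself, move the transpose across the inner
  product, apply Cauchy-Schwarz and cancel one factor. This lets bounds on \<open>M\<close> serve
  for the transposed matrices of the adjoint formulas.\<close>

lemma norm_transpose_mult_vec_le:
  fixes M :: "real^'m^'n"
  shows "norm (transpose M *v v) \<le> spectral_norm M * norm v"
proof (cases "transpose M *v v = 0")
  case True
  then show ?thesis by (simp add: spectral_norm_nonneg)
next
  case False
  let ?w = "transpose M *v v"
  have "norm ?w * norm ?w = v \<bullet> (M *v ?w)"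
    by (simp add: transpose_matrix_vector flip: dot_lmul_matrix power2_eq_square power2_norm_eq_inner)
  also have "\<dots> \<le> norm v * (spectral_norm M * norm ?w)"
    using norm_cauchy_schwarz[of v "M *v ?w"] norm_mult_vec_le[of M ?w]
    by (meson mult_left_mono norm_ge_zero order_trans)
  finally have "norm ?w * norm ?w \<le> (spectral_norm M * norm v) * norm ?w"
    by (simp add: mult_ac)
  then show ?thesis using False by simp
qed

text \<open>Cauchy-Schwarz against the all-ones vector; every factor sqrt m in the final constants
  comes from here.\<close>

lemma sum_abs_nth_le: "(\<Sum>k\<in>UNIV. \<bar>x $ k\<bar>) \<le> sqrt (real CARD('m)) * norm (x :: real^'m)"
  using L2_set_mult_ineq[of "\<lambda>k. x $ k" "\<lambda>_. 1" UNIV]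
  by (simp add: norm_vec_def L2_set_def mult.commute)

text \<open>The product is the combination of the columns \<open>P k *v y\<close> with the entries
  of \<open>x\<close> as weights. Each column has norm at most \<open>C * norm y\<close>, and the l1
  norm of the weights costs the factor sqrt m.\<close>

lemma norm_columns_mult_vec_le:
  fixes P :: "'m::finite \<Rightarrow> real^'n^'n"
  assumes "\<And>k. spectral_norm (P k) \<le> C"
  shows "norm ((\<chi> i k. (P k *v y) $ i) *v x) \<le> sqrt (real CARD('m)) * C * norm y * norm x"
proof -
  have C: "0 \<le> C" using assms spectral_norm_nonneg order_trans by blast
  have "(\<chi> i k. (P k *v y) $ i) *v x = (\<Sum>k\<in>UNIV. x $ k *\<^sub>R (P k *v y))"
    by (simp add: vec_eq_iff matrix_vector_mult_def mult.commute)
  also have "norm \<dots> \<le> (\<Sum>k\<in>UNIV. \<bar>x $ k\<bar> * (C * norm y))"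
  proof (rule sum_norm_le)
    fix k
    have "norm (P k *v y) \<le> C * norm y"
      using norm_mult_vec_le[of "P k" y] assms[of k] mult_right_mono norm_ge_zero order_trans by metis
    then show "norm (x $ k *\<^sub>R (P k *v y)) \<le> \<bar>x $ k\<bar> * (C * norm y)"
      by (simp add: mult_left_mono)
  qed
  also have "\<dots> = (\<Sum>k\<in>UNIV. \<bar>x $ k\<bar>) * (C * norm y)" by (simp add: sum_distrib_right)
  also have "\<dots> \<le> (sqrt (real CARD('m)) * norm x) * (C * norm y)"
    by (rule mult_right_mono[OF sum_abs_nth_le]) (simp add: C)
  finally show ?thesis by (simp add: mult_ac)
qed

section \<open>Stability constants of invertible matrices\<close>

lemma norm_le_matrix_inv:
  fixes M :: "real^'n^'n"
  assumes "invertible M"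
  shows "norm x \<le> spectral_norm (matrix_inv M) * norm (M *v x)"
  using norm_mult_vec_le[of "matrix_inv M" "M *v x"] matrix_inv_works[OF assms]
  by (simp add: matrix_vector_mul_assoc)

text \<open>The transposed inverse is a left inverse of the transpose, so the same constant controls
  both the state and the adjoint equation.\<close>

lemma norm_le_transpose_matrix_inv:
  fixes M :: "real^'n^'n"
  assumes "invertible M"
  shows "norm x \<le> spectral_norm (matrix_inv M) * norm (transpose M *v x)"
proof -
  have "transpose (matrix_inv M) ** transpose M = mat 1"
    using matrix_inv_works(1)[OF assms] by (simp flip: matrix_transpose_mul)
  then show ?thesis
    using norm_transpose_mult_vec_le[of "matrix_inv M" "transpose M *v x"]
    by (simp add: matrix_vector_mul_assoc del: transpose_matrix_vector)
qed

lemma spectral_norm_matrix_inv_bounded: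
  fixes A :: "'a::topological_space \<Rightarrow> real^'n^'n"
  assumes cont: "continuous_on K A" and "compact K" and inv: "\<And>z. z \<in> K \<Longrightarrow> invertible (A z)"
  obtains B where "\<And>z. z \<in> K \<Longrightarrow> spectral_norm (matrix_inv (A z)) \<le> B"
proof (cases "K = {}")
  case True
  then show ?thesis using that by blast
next
  case False
  let ?S = "K \<times> sphere (0 :: real^'n) 1"
  \<comment> \<open>Any coordinate vector shows that the sphere is nonempty;
    \<open>undefined\<close> is merely some index.\<close>
  have "axis undefined 1 \<in> sphere (0 :: real^'n) 1" by simp
  then have ne: "?S \<noteq> {}" using False by blast
  have "continuous_on ?S (\<lambda>p. A (fst p))"
    by (rule continuous_on_compose2[OF cont]) (auto intro: continuous_on_fst)
  then have "continuous_on ?S (\<lambda>p. norm (A (fst p) *v snd p))"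
    by (intro continuous_on_norm bounded_bilinear.continuous_on[OF bounded_bilinear_matrix_vector_mult]
        continuous_on_snd continuous_on_id)
  from continuous_attains_inf[OF compact_Times[OF \<open>compact K\<close> compact_sphere] ne this]
  obtain z0 x0 where z0: "z0 \<in> K" and x0: "norm x0 = 1"
    and min: "\<And>z x. z \<in> K \<Longrightarrow> norm x = 1 \<Longrightarrow> norm (A z0 *v x0) \<le> norm (A z *v x)"
    by fastforce
  define \<mu> where "\<mu> = norm (A z0 *v x0)"
  \<comment> \<open>Invertibility at the minimizer makes the minimum positive, since
    \<open>x0\<close> is a unit vector.\<close>
  have "A z0 *v x0 \<noteq> 0"
    using norm_le_matrix_inv[OF inv[OF z0], of x0] x0 by auto
  then have \<mu>: "\<mu> > 0" by (simp add: \<mu>_def)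
  \<comment> \<open>By homogeneity the bound on the unit sphere extends to all vectors; applied to
    \<open>matrix_inv (A z) *v v\<close> it bounds the inverse by \<open>1 / \<mu>\<close>.\<close>
  have low: "\<mu> * norm x \<le> norm (A z *v x)" if "z \<in> K" for z x
  proof (cases "x = 0")
    case False
    then have "\<mu> \<le> norm (A z *v (x /\<^sub>R norm x))"
      unfolding \<mu>_def using that by (intro min) simp_all
    then show ?thesis
      using False by (simp add: matrix_vector_mult_scaleR field_simps)
  qed simp
  have "spectral_norm (matrix_inv (A z)) \<le> 1 / \<mu>" if "z \<in> K" for z
  proof (rule spectral_norm_leI)
    fix v
    show "norm (matrix_inv (A z) *v v) \<le> 1 / \<mu> * norm v"
      using low[OF that, of "matrix_inv (A z) *v v"] matrix_inv_works[OF inv[OF that]] \<mu>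
      by (simp add: matrix_vector_mul_assoc field_simps)
  qed
  then show ?thesis using that by blast
qed

section \<open>Partial gradients as components of the full gradient, and suprema in the extended
  reals\<close>

lemma gradient_Pair:
  fixes F :: "(real^'m) \<times> (real^'n) \<Rightarrow> real"
  assumes "F differentiable (at (z, y))"
  shows "gradient F (z, y) = (grad_z F z y, grad_y F z y)"
proof -
  define g where "g = gradient F (z, y)"
  have F: "(F has_derivative (\<lambda>h. h \<bullet> g)) (at (z, y))"
    using GDERIV_gradient[OF assms] by (simp add: gderiv_def g_def)
  have "GDERIV (\<lambda>z'. F (z', y)) z :> fst g"
    unfolding gderiv_def
    using has_derivative_compose[OF has_derivative_Pair[OF has_derivative_ident
          has_derivative_const[of y]] F] by (simp add: inner_prod_def)
  moreover have "GDERIV (\<lambda>y'. F (z, y')) y :> snd g"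
    unfolding gderiv_def
    using has_derivative_compose[OF has_derivative_Pair[OF has_derivative_const[of z]
          has_derivative_ident] F] by (simp add: inner_prod_def)
  ultimately show ?thesis
    by (simp add: grad_z_def grad_y_def gradient_eqI g_def)
qed

lemma ereal_SUP_real_finite:
  fixes f :: "'a \<Rightarrow> ereal"
  assumes "K \<noteq> {}" and "\<And>z. z \<in> K \<Longrightarrow> 0 \<le> f z" and "\<And>z. z \<in> K \<Longrightarrow> f z \<le> ereal B"
  shows "\<bar>SUP z\<in>K. f z\<bar> \<noteq> \<infinity>"
proof -
  have "(SUP z\<in>K. f z) \<le> ereal B" using assms(3) by (rule SUP_least)
  moreover obtain z where "z \<in> K" using assms(1) by blast
  then have "0 \<le> (SUP z\<in>K. f z)" using assms(2) SUP_upper2 by metis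
  ultimately show ?thesis by auto
qed

text \<open>Finiteness is essential here, because \<open>real_of_ereal\<close> sends both infinities
  to 0.\<close>

lemma le_real_of_ereal_SUP:
  fixes f :: "'a \<Rightarrow> ereal"
  assumes "\<bar>SUP z\<in>K. f z\<bar> \<noteq> \<infinity>" and "z \<in> K" and "ereal a \<le> f z"
  shows "a \<le> real_of_ereal (SUP z\<in>K. f z)"
proof -
  have "ereal a \<le> (SUP z\<in>K. f z)" using assms(2,3) by (rule SUP_upper2)
  then show ?thesis using assms(1) by (simp add: ereal_le_real_iff)
qed

section \<open>Errors and a priori bounds for states and adjoints\<close>

lemma exact_state_mem_inexact_states:
  assumes "invertible (A z)" and "0 \<le> tau"
  shows "exact_state A b z \<in> inexact_states A b tau z"
  using exact_state_solves[of A, OF assms(1)] assms(2) by (simp add: inexact_states_def residual_def)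

lemma inexact_state_error:
  fixes A :: "real^'m \<Rightarrow> real^'n^'n"
  assumes "invertible (A z)" and "y \<in> inexact_states A b tau z"
  shows "norm (y - exact_state A b z) \<le> C_R A z * tau"
proof -
  have "norm (A z *v (y - exact_state A b z)) \<le> tau"
    using assms(2) exact_state_solves[of A, OF assms(1)]
    by (simp add: inexact_states_def residual_def matrix_vector_mult_diff_distrib)
  then show ?thesis
    using norm_le_matrix_inv[OF assms(1)] mult_left_mono[OF _ spectral_norm_nonneg]
    unfolding C_R_def by (meson order_trans)
qed

text \<open>A bound independent of \<open>y\<close>: over a compact set of \<open>z\<close> it
  becomes uniform and makes the supremum of the state norms finite.\<close>

lemma norm_inexact_state_le:
  fixes A :: "real^'m \<Rightarrow> real^'n^'n"
  assumes "invertible (A z)" and "y \<in> inexact_states A b tau z"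
  shows "norm y \<le> C_R A z * (norm (b z) + tau)"
proof -
  have "norm (A z *v y) \<le> norm (b z) + tau"
    using assms(2) norm_triangle_sub[of "A z *v y" "b z"]
    by (simp add: inexact_states_def residual_def)
  then show ?thesis
    using norm_le_matrix_inv[OF assms(1)] mult_left_mono[OF _ spectral_norm_nonneg]
    unfolding C_R_def by (meson order_trans)
qed

lemma inexact_adjoint_error:
  fixes A :: "real^'m \<Rightarrow> real^'n^'n"
  assumes "invertible (A z)" and "\<psi> \<in> inexact_adjoints A F tau z y"
  shows "norm (\<psi> - exact_adjoint A F z y) \<le> C_R A z * tau"
proof -
  have "norm (transpose (A z) *v (\<psi> - exact_adjoint A F z y)) \<le> tau"
    using assms(2) exact_adjoint_solves[of A, OF assms(1)]
    by (simp add: inexact_adjoints_def matrix_vector_mult_diff_distrib del: transpose_matrix_vector)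
  then show ?thesis
    using norm_le_transpose_matrix_inv[OF assms(1)] mult_left_mono[OF _ spectral_norm_nonneg]
    unfolding C_R_def by (meson order_trans)
qed

text \<open>The exact adjoint at \<open>y\<close> is an inexact adjoint at \<open>y'\<close> whose
  tolerance is the difference of the two state gradients.\<close>

lemma exact_adjoint_diff_le:
  fixes A :: "real^'m \<Rightarrow> real^'n^'n"
  assumes "invertible (A z)"
  shows "norm (exact_adjoint A F z y - exact_adjoint A F z y')
    \<le> C_R A z * norm (grad_y F z y - grad_y F z y')"
  by (rule inexact_adjoint_error[where A = A, OF assms])
    (simp add: inexact_adjoints_def exact_adjoint_solves[of A, OF assms] del: transpose_matrix_vector)

lemma norm_exact_adjoint_le:
  fixes A :: "real^'m \<Rightarrow> real^'n^'n"
  assumes "invertible (A z)"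
  shows "norm (exact_adjoint A F z y) \<le> C_R A z * norm (grad_y F z y)"
  using norm_le_transpose_matrix_inv[OF assms, of "exact_adjoint A F z y"]
  by (simp add: C_R_def exact_adjoint_solves[of A, OF assms] del: transpose_matrix_vector)

section \<open>The partial Jacobian of the residual and the splitting of the gradient error\<close>

lemma spectral_norm_residual_dz_le:
  fixes A :: "real^'m \<Rightarrow> real^'n^'n"
  assumes "A differentiable (at z)" and "b differentiable (at z)"
    and CA: "\<And>k. spectral_norm (partial_deriv k A z) \<le> CA"
    and Cb: "spectral_norm (jacobian b (at z)) \<le> Cb"
  shows "spectral_norm (residual_dz A b z y) \<le> sqrt (real CARD('m)) * CA * norm y + Cb"
proof (rule spectral_norm_leI)
  fix x
  let ?c = "\<chi> i k. (partial_deriv k A z *v y) $ i" and ?J = "jacobian b (at z)"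
  have "norm (residual_dz A b z y *v x) \<le> norm (?c *v x) + norm (?J *v x)"
    unfolding residual_dz_eq[OF assms(1,2)] by (simp add: matrix_vector_mult_diff_rdistrib norm_triangle_ineq4)
  moreover have "norm (?c *v x) \<le> sqrt (real CARD('m)) * CA * norm y * norm x"
    using CA by (rule norm_columns_mult_vec_le)
  moreover have "norm (?J *v x) \<le> Cb * norm x"
    using norm_mult_vec_le[of ?J x] mult_right_mono[OF Cb, of "norm x"] by simp
  ultimately show "norm (residual_dz A b z y *v x) \<le> (sqrt (real CARD('m)) * CA * norm y + Cb) * norm x"
    by (simp add: distrib_right)
qed

text \<open>The Jacobian of \<open>b\<close> cancels and the rest is linear in the state, so only
  \<open>CA\<close> enters the Lipschitz constant.\<close>

lemma spectral_norm_residual_dz_diff_le: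
  fixes A :: "real^'m \<Rightarrow> real^'n^'n"
  assumes "A differentiable (at z)" and "b differentiable (at z)"
    and CA: "\<And>k. spectral_norm (partial_deriv k A z) \<le> CA"
  shows "spectral_norm (residual_dz A b z y - residual_dz A b z y')
    \<le> sqrt (real CARD('m)) * CA * norm (y - y')"
proof -
  have "residual_dz A b z y - residual_dz A b z y' = (\<chi> i k. (partial_deriv k A z *v (y - y')) $ i)"
    unfolding residual_dz_eq[OF assms(1,2)]
    by (simp add: vec_eq_iff matrix_vector_mult_diff_distrib)
  then show ?thesis
    using norm_columns_mult_vec_le[of "\<lambda>k. partial_deriv k A z", OF CA]
    by (simp add: spectral_norm_leI)
qed

text \<open>A telescoping identity with a free intermediate vector \<open>\<psi>y\<close>. The
  adjoint differences are paired with the Jacobian at \<open>y\<close> and at \<open>ys\<close>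
  respectively, which leaves the Jacobian difference acting on \<open>\<psi>y\<close>.\<close>

lemma adjoint_gradient_error_split:
  fixes A :: "real^'m \<Rightarrow> real^'n^'n"
  shows "norm (adjoint_gradient A b F z y \<psi> - adjoint_gradient A b F z ys \<psi>s)
    \<le> norm (grad_z F z y - grad_z F z ys)
      + spectral_norm (residual_dz A b z y) * norm (\<psi> - \<psi>y)
      + spectral_norm (residual_dz A b z ys) * norm (\<psi>y - \<psi>s)
      + spectral_norm (residual_dz A b z y - residual_dz A b z ys) * norm \<psi>y"
proof -
  let ?R = "residual_dz A b z"
  have "transpose (?R y - ?R ys) = transpose (?R y) - transpose (?R ys)"
    by (simp add: transpose_def vec_eq_iff)
  then have "transpose (?R y - ?R ys) *v \<psi>y = transpose (?R y) *v \<psi>y - transpose (?R ys) *v \<psi>y"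
    by (simp add: matrix_vector_mult_diff_rdistrib del: transpose_matrix_vector)
  then have "adjoint_gradient A b F z y \<psi> - adjoint_gradient A b F z ys \<psi>s
    = (grad_z F z y - grad_z F z ys) - transpose (?R y) *v (\<psi> - \<psi>y)
      - transpose (?R ys) *v (\<psi>y - \<psi>s) - transpose (?R y - ?R ys) *v \<psi>y"
    unfolding adjoint_gradient_def
    by (simp add: matrix_vector_mult_diff_distrib del: transpose_matrix_vector)
  also have "norm \<dots> \<le> norm (grad_z F z y - grad_z F z ys) + norm (transpose (?R y) *v (\<psi> - \<psi>y))
      + norm (transpose (?R ys) *v (\<psi>y - \<psi>s)) + norm (transpose (?R y - ?R ys) *v \<psi>y)"
    by (rule norm_triangle_le_diff order.refl add_right_mono)+
  finally show ?thesis
    using norm_transpose_mult_vec_le[of "?R y" "\<psi> - \<psi>y"]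
      norm_transpose_mult_vec_le[of "?R ys" "\<psi>y - \<psi>s"]
      norm_transpose_mult_vec_le[of "?R y - ?R ys" \<psi>y]
    by linarith
qed

section \<open>Finiteness of the three suprema, then the uniform error bound\<close>

theorem mainTheorem2:
  fixes A :: "real^'m \<Rightarrow> real^'n^'n" and b :: "real^'m \<Rightarrow> real^'n"
    and F :: "(real^'m) \<times> (real^'n) \<Rightarrow> real"
    and Zc :: "(real^'m) set" and tauR tauPsi CA Cb LF :: real
  assumes A_C1: "C1_map A" and A_GL: "\<And>z. invertible (A z)" and b_C1: "C1_map b"
    and "tauR > 0" and "tauPsi > 0"
    and "Zc \<noteq> {}" and "compact Zc"
    and A_Lip: "\<And>k. spectral_Lipschitz (partial_deriv k A)"
    and "CA > 0" and A_bound: "\<And>z k. spectral_norm (partial_deriv k A z) \<le> CA"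
    and b_Lip: "spectral_Lipschitz (\<lambda>z. jacobian b (at z))"
    and "Cb > 0" and b_bound: "\<And>z. spectral_norm (jacobian b (at z)) \<le> Cb"
    and F_C1: "C1_map F"
    and F_smooth: "\<And>w1 w2. norm (gradient F w1 - gradient F w2) \<le> LF * norm (w1 - w2)"
  shows "let supR = (SUP z\<in>Zc. ereal (C_R A z));
             supY = (SUP z\<in>Zc. C_Y A b tauR z);
             supM = (SUP z\<in>Zc. M_F A b F tauR z);
             CR = real_of_ereal supR; CY = real_of_ereal supY; MF = real_of_ereal supM;
             m = real CARD('m);
             Dpsi = (sqrt m * CA * CY + Cb) * CR;
             DR = LF * CR + LF * (sqrt m * CA * CY + Cb) * CR\<^sup>2 + sqrt m * CA * MF * CR\<^sup>2
         in \<bar>supR\<bar> \<noteq> \<infinity> \<and> \<bar>supY\<bar> \<noteq> \<infinity> \<and> \<bar>supM\<bar> \<noteq> \<infinity> \<and>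
            (\<forall>z\<in>Zc. \<forall>y\<in>inexact_states A b tauR z. \<forall>\<psi>\<in>inexact_adjoints A F tauPsi z y.
               norm (adjoint_gradient A b F z y \<psi> - gradient (reduced_objective A b F) z)
                 \<le> DR * tauR + Dpsi * tauPsi)"
proof -
  define supR where "supR = (SUP z\<in>Zc. ereal (C_R A z))"
  define supY where "supY = (SUP z\<in>Zc. C_Y A b tauR z)"
  define supM where "supM = (SUP z\<in>Zc. M_F A b F tauR z)"
  define CR CY MF where "CR = real_of_ereal supR" and "CY = real_of_ereal supY"
    and "MF = real_of_ereal supM"
  define m where "m = sqrt (real CARD('m))"
  note A_diff = C1_map_differentiable[OF A_C1] and b_diff = C1_map_differentiable[OF b_C1]
    and F_diff = C1_map_differentiable[OF F_C1]
  have cont: "continuous_on Zc A" "continuous_on Zc b"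
    using A_diff b_diff
    by (auto intro!: continuous_at_imp_continuous_on differentiable_imp_continuous_within)
  \<comment> \<open>The sign of \<open>LF\<close> is forced by the smoothness inequality at two
    points at distance 1.\<close>
  have LF: "0 \<le> LF"
  proof -
    have "0 \<le> LF * norm (axis undefined 1 :: real^'m, 0 :: real^'n)"
      using order_trans[OF norm_ge_zero F_smooth[of "(axis undefined 1, 0)" 0]] by simp
    then show ?thesis by (simp add: norm_Pair)
  qed
  have m: "0 \<le> m" by (simp add: m_def)

  obtain BR where BR: "C_R A z \<le> BR" if "z \<in> Zc" for z
    using spectral_norm_matrix_inv_bounded[OF cont(1) \<open>compact Zc\<close> A_GL] unfolding C_R_def by blast
  obtain Bb where Bb: "norm (b z) \<le> Bb" if "z \<in> Zc" for z
    using compact_imp_bounded[OF compact_continuous_image[OF cont(2) \<open>compact Zc\<close>]]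
    by (auto simp: bounded_iff)
  obtain Bz where Bz: "norm z \<le> Bz" if "z \<in> Zc" for z
    using compact_imp_bounded[OF \<open>compact Zc\<close>] by (auto simp: bounded_iff)
  have C_R0: "0 \<le> C_R A z" for z by (simp add: C_R_def spectral_norm_nonneg)
  define BY where "BY = BR * (Bb + tauR)"
  have BY: "norm y \<le> BY" if "z \<in> Zc" "y \<in> inexact_states A b tauR z" for z y
  proof -
    have "C_R A z * (norm (b z) + tauR) \<le> BY"
      unfolding BY_def using BR[OF that(1)] Bb[OF that(1)] C_R0[of z] \<open>tauR > 0\<close>
      by (intro mult_mono) auto
    then show ?thesis using norm_inexact_state_le[of A z, OF A_GL that(2)] by simp
  qed
  \<comment> \<open>A Lipschitz gradient grows at most linearly, here measured from the origin, and
    \<open>z\<close> and \<open>y\<close> are both uniformly bounded.\<close>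
  have BM: "norm (grad_y F z y) \<le> norm (gradient F 0) + LF * (Bz + BY)"
    if "z \<in> Zc" "y \<in> inexact_states A b tauR z" for z y
  proof -
    have "norm (grad_y F z y) \<le> norm (gradient F (z, y))"
      by (simp add: gradient_Pair[OF F_diff] norm_snd_le)
    also have "\<dots> \<le> norm (gradient F 0) + norm (gradient F (z, y) - gradient F 0)"
      by (rule norm_triangle_sub)
    also have "norm (gradient F (z, y) - gradient F 0) \<le> LF * norm (z, y)"
      using F_smooth[of "(z, y)" 0] by simp
    also have "LF * norm (z, y) \<le> LF * (Bz + BY)"
      using norm_Pair_le[of z y] Bz[OF that(1)] BY[OF that] LF by (intro mult_left_mono) auto
    finally show ?thesis by simp
  qed
  \<comment> \<open>The exact state serves twice: it keeps the inner suprema from being minus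
    infinity, and it lets bounds over all inexact states apply at the exact one.\<close>
  note ys_mem = exact_state_mem_inexact_states[of A, OF A_GL less_imp_le[OF \<open>tauR > 0\<close>]]
  have finR: "\<bar>supR\<bar> \<noteq> \<infinity>"
    unfolding supR_def using BR C_R0 by (intro ereal_SUP_real_finite[OF \<open>Zc \<noteq> {}\<close>]) auto
  have finY: "\<bar>supY\<bar> \<noteq> \<infinity>"
    unfolding supY_def
  proof (rule ereal_SUP_real_finite[OF \<open>Zc \<noteq> {}\<close>])
    show "0 \<le> C_Y A b tauR z" for z
      unfolding C_Y_def by (rule SUP_upper2[OF ys_mem]) simp
    show "C_Y A b tauR z \<le> ereal BY" if "z \<in> Zc" for z
      unfolding C_Y_def using BY[OF that] by (intro SUP_least) simp
  qed
  have finM: "\<bar>supM\<bar> \<noteq> \<infinity>"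
    unfolding supM_def
  proof (rule ereal_SUP_real_finite[OF \<open>Zc \<noteq> {}\<close>])
    show "0 \<le> M_F A b F tauR z" for z
      unfolding M_F_def by (rule SUP_upper2[OF ys_mem]) simp
    show "M_F A b F tauR z \<le> ereal (norm (gradient F 0) + LF * (Bz + BY))" if "z \<in> Zc" for z
      unfolding M_F_def using BM[OF that] by (intro SUP_least) simp
  qed

  have "norm (adjoint_gradient A b F z y \<psi> - gradient (reduced_objective A b F) z)
      \<le> (LF * CR + LF * (m * CA * CY + Cb) * CR\<^sup>2 + m * CA * MF * CR\<^sup>2) * tauR
        + ((m * CA * CY + Cb) * CR) * tauPsi"
    if z: "z \<in> Zc" and y: "y \<in> inexact_states A b tauR z"
      and \<psi>: "\<psi> \<in> inexact_adjoints A F tauPsi z y" for z y \<psi>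
  proof -
    define ys where "ys = exact_state A b z"
    define D where "D = m * CA * CY + Cb"
    let ?\<psi>s = "exact_adjoint A F z ys" and ?\<psi>y = "exact_adjoint A F z y"
    let ?R = "residual_dz A b z"
    have CR: "C_R A z \<le> CR"
      unfolding CR_def supR_def
      by (rule le_real_of_ereal_SUP[OF finR[unfolded supR_def] z]) simp
    have CR0: "0 \<le> CR" using CR C_R0[of z] by simp
    have CY: "norm y' \<le> CY" if "y' \<in> inexact_states A b tauR z" for y'
      unfolding CY_def supY_def
      by (rule le_real_of_ereal_SUP[OF finY[unfolded supY_def] z])
        (use that in \<open>auto simp: C_Y_def intro: SUP_upper\<close>)
    have MF: "norm (grad_y F z y) \<le> MF"
      unfolding MF_def supM_def
      by (rule le_real_of_ereal_SUP[OF finM[unfolded supM_def] z])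
        (use y in \<open>auto simp: M_F_def intro: SUP_upper\<close>)
    have R_le: "spectral_norm (?R y') \<le> D" if "y' \<in> inexact_states A b tauR z" for y'
    proof -
      have "m * CA * norm y' \<le> m * CA * CY"
        using CY[OF that] m \<open>CA > 0\<close> by (intro mult_left_mono) auto
      then show ?thesis
        using spectral_norm_residual_dz_le[OF A_diff b_diff A_bound b_bound, of z y']
        unfolding D_def m_def by linarith
    qed
    have D0: "0 \<le> D" using R_le[OF y] spectral_norm_nonneg order_trans by blast
    have dy: "norm (y - ys) \<le> CR * tauR"
      using inexact_state_error[of A z, OF A_GL y] mult_right_mono[OF CR less_imp_le[OF \<open>tauR > 0\<close>]]
      unfolding ys_def by (rule order_trans)
    \<comment> \<open>The two points differ only in the state, so their distance is the state error;
      both partial gradients inherit the bound as components.\<close>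
    have dF: "norm (gradient F (z, y) - gradient F (z, ys)) \<le> LF * (CR * tauR)"
      using F_smooth[of "(z, y)" "(z, ys)"] mult_left_mono[OF dy LF] by (simp add: norm_Pair)
    have dFz: "norm (grad_z F z y - grad_z F z ys) \<le> LF * (CR * tauR)"
      and dFy: "norm (grad_y F z y - grad_y F z ys) \<le> LF * (CR * tauR)"
      using norm_fst_le norm_snd_le dF order_trans by (simp_all add: gradient_Pair[OF F_diff]) blast+
    have d\<psi>: "norm (\<psi> - ?\<psi>y) \<le> CR * tauPsi"
      using inexact_adjoint_error[of A z, OF A_GL \<psi>]
        mult_right_mono[OF CR less_imp_le[OF \<open>tauPsi > 0\<close>]]
      by (rule order_trans)
    \<comment> \<open>The state error is amplified by \<open>LF\<close> in the right-hand side and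
      by \<open>CR\<close> again in the adjoint solve, whence the square of
      \<open>CR\<close>.\<close>
    have d\<psi>s: "norm (?\<psi>y - ?\<psi>s) \<le> CR * (LF * (CR * tauR))"
      using exact_adjoint_diff_le[of A z F y ys, OF A_GL] mult_mono[OF CR dFy CR0 norm_ge_zero]
      by (rule order_trans)
    have \<psi>y: "norm ?\<psi>y \<le> CR * MF"
      using norm_exact_adjoint_le[of A z F y, OF A_GL] mult_mono[OF CR MF CR0 norm_ge_zero]
      by (rule order_trans)
    have mCA: "0 \<le> m * CA" using m \<open>CA > 0\<close> by simp
    have dR: "spectral_norm (?R y - ?R ys) \<le> m * CA * (CR * tauR)"
      using spectral_norm_residual_dz_diff_le[OF A_diff b_diff A_bound, of z y ys]
        mult_left_mono[OF dy mCA]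
      unfolding m_def by (rule order_trans)
    have "gradient (reduced_objective A b F) z = adjoint_gradient A b F z ys ?\<psi>s"
      unfolding ys_def
      by (intro gradient_eqI gradient_reduced_objective A_diff b_diff A_GL F_diff)
    moreover have "spectral_norm (?R y) * norm (\<psi> - ?\<psi>y) \<le> D * (CR * tauPsi)"
      using mult_mono[OF R_le[OF y] d\<psi> D0] by simp
    moreover have "spectral_norm (?R ys) * norm (?\<psi>y - ?\<psi>s) \<le> D * (CR * (LF * (CR * tauR)))"
      using mult_mono[OF R_le d\<psi>s D0] ys_mem by (simp add: ys_def)
    moreover have "spectral_norm (?R y - ?R ys) * norm ?\<psi>y \<le> m * CA * (CR * tauR) * (CR * MF)"
      using mult_mono[OF dR \<psi>y] mCA CR0 \<open>tauR > 0\<close> by simp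
    \<comment> \<open>In order, the four terms yield \<open>LF * CR\<close>, the coefficient of
      \<open>tauPsi\<close>, the term of the \<open>tauR\<close> coefficient with
      \<open>LF * D\<close>, and the one with \<open>MF\<close>.\<close>
    ultimately have "norm (adjoint_gradient A b F z y \<psi> - gradient (reduced_objective A b F) z)
        \<le> LF * (CR * tauR) + D * (CR * tauPsi) + D * (CR * (LF * (CR * tauR)))
          + m * CA * (CR * tauR) * (CR * MF)"
      using adjoint_gradient_error_split[of A b F z y \<psi> ys ?\<psi>s ?\<psi>y] dFz by simp
    also have "\<dots> = (LF * CR + LF * D * CR\<^sup>2 + m * CA * MF * CR\<^sup>2) * tauR + (D * CR) * tauPsi"
      by (simp add: algebra_simps power2_eq_square)
    finally show ?thesis unfolding D_def .
  qed
  then show ?thesis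
    using finR finY finM
    unfolding Let_def CR_def CY_def MF_def supR_def supY_def supM_def m_def by blast
qed

end
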